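(* For every integer $k\ge 2$, the quantity $C(k)$ is attained at a simplicial conical partition; that is, there is a partition $A_1,\ldots,A_k$ of $\mathbb{R}^{k-1}$ into measurable sets with $\sum_{j=1}^k\left\|\int_{A_j}x\,d\gamma_{k-1}(x)\right\|_2^2=C(k)$ of the following form: if (after relabeling) $A_1,\ldots,A_m$ are the elements of the partition of positive $\gamma_{k-1}$-measure, then, writing $\mathbb{R}^{k-1}=\mathbb{R}^{m-1}\times\mathbb{R}^{k-m}$, each $A_j=B_j\times\mathbb{R}^{k-m}$ ($1\le j\le m$) where $B_j\subseteq\mathbb{R}^{m-1}$ is a cone with cusp at $0$ whose base is a simplex.
   Context: $\gamma_d$ denotes the standard Gaussian measure on $\mathbb{R}^d$ (density $(2\pi)^{-d/2}e^{-\|x\|_2^2/2}$). $C(k)$ is the maximum, over all partitions $A_1,\ldots,A_k$ of $\mathbb{R}^{k-1}$ into measurable sets, of $\sum_{j=1}^k\left\|\int_{A_j}x\,d\gamma_{k-1}(x)\right\|_2^2$ (equivalently, the supremum of $\sum_{j=1}^k\|\int_{\mathbb{R}^{k-1}}xf_j(x)\,d\gamma_{k-1}(x)\|_2^2$ over measurable $f_1,\ldots,f_k\ge 0$ with $\sum_j f_j\le 1$; this supremum is attained by indicator functions of a partition). *)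

theory Defs
  imports "HOL-Probability.Probability"
begin

(* Throughout, R^(k-1) is real ^ 'n with CARD('n) = k - 1. *)

definition std_gauss :: "(real ^ 'n) measure" where
  "std_gauss = density lborel
     (\<lambda>x. ennreal ((2 * pi) powr (- (real CARD('n) / 2)) * exp (- (norm x)\<^sup>2 / 2)))"

(* The parts are indexed by 1, ..., k; values of A outside {1..k} are irrelevant.
   Parts may be empty or null. *)
definition measurable_partition :: "nat \<Rightarrow> (nat \<Rightarrow> (real ^ 'n) set) \<Rightarrow> bool" where
  "measurable_partition k A \<longleftrightarrow>
     (\<forall>j\<in>{1..k}. A j \<in> sets borel) \<and> disjoint_family_on A {1..k} \<and> (\<Union>j\<in>{1..k}. A j) = UNIV"

definition moment_sum :: "nat \<Rightarrow> (nat \<Rightarrow> (real ^ 'n) set) \<Rightarrow> real" where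
  "moment_sum k A = (\<Sum>j=1..k. (norm (LINT x:A j|std_gauss. x))\<^sup>2)"

(* C(k) is kernel_C TYPE('n) k when CARD('n) = k - 1. The supremum is over a set that is
   bounded above, see bdd_above_moment_sum below. *)
definition kernel_C :: "'n::finite itself \<Rightarrow> nat \<Rightarrow> real" where
  "kernel_C _ k =
     (SUP A\<in>{A :: nat \<Rightarrow> (real ^ 'n) set. measurable_partition k A}. moment_sum k A)"

(* A cone with cusp at 0 over a (d-1)-dimensional simplex S whose affine hull misses 0.
   The parts of a partition are pairwise disjoint, whereas the closed cones touch along their
   boundaries. So the base actually used is a set T that agrees with S up to relative boundary
   points, and membership of the cusp is left open. *)
definition simplicial_cone :: "nat \<Rightarrow> 'a::euclidean_space set \<Rightarrow> bool" where
  "simplicial_cone d B \<longleftrightarrow>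
     (\<exists>S T. (int d - 1) simplex S \<and> 0 \<notin> affine hull S \<and>
            rel_interior S \<subseteq> T \<and> T \<subseteq> S \<and>
            B - {0} = {t *\<^sub>R x |t x. 0 < t \<and> x \<in> T})"

definition coord_subspace :: "'n set \<Rightarrow> (real ^ 'n) set" where
  "coord_subspace I = {x. \<forall>i. i \<notin> I \<longrightarrow> x $ i = 0}"

definition coord_proj :: "'n set \<Rightarrow> real ^ 'n \<Rightarrow> real ^ 'n" where
  "coord_proj I x = (\<chi> i. if i \<in> I then x $ i else 0)"

(* With m = card J the number of parts of positive measure, the coordinates in I (m - 1 many)
   span the factor R^(m-1), and those outside I (k - m many) span R^(k-m). Hence
   {x. coord_proj I x : B} is the product B x R^(k-m). *)
definition simplicial_conical :: "nat \<Rightarrow> (nat \<Rightarrow> (real ^ 'n) set) \<Rightarrow> bool" where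
  "simplicial_conical k A \<longleftrightarrow>
     (let J = {j\<in>{1..k}. emeasure std_gauss (A j) > 0} in
      \<exists>I. card I + 1 = card J \<and>
          (\<forall>j\<in>J. \<exists>B. B \<subseteq> coord_subspace I \<and> simplicial_cone (card I) B \<and>
                        A j = {x. coord_proj I x \<in> B}))"

lemma integrable_std_gauss_norm: "integrable (std_gauss :: (real ^ 'n) measure) norm"
proof -
  define c where "c = (2 * pi) powr (- (real CARD('n) / 2))"
  have c: "c \<ge> 0" by (simp add: c_def)
  let ?g = "\<lambda>x::real ^ 'n. exp (- (norm x)\<^sup>2 / 4)"
  have prod: "?g x = (\<Prod>b\<in>Basis. exp (- (x \<bullet> b)\<^sup>2 / 4))" for x
  proof -
    have "(norm x)\<^sup>2 = (\<Sum>b\<in>Basis. (x \<bullet> b)\<^sup>2)"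
      by (subst power2_norm_eq_inner, subst euclidean_inner) (simp add: power2_eq_square)
    thus ?thesis
      by (simp add: exp_sum[symmetric] sum_negf sum_divide_distrib[symmetric])
  qed
  have "exp (- y\<^sup>2 / 4) = sqrt (4 * pi) * normal_density 0 (sqrt 2) y" for y :: real
    by (simp add: normal_density_def)
  hence int1: "integrable lborel (\<lambda>y::real. exp (- y\<^sup>2 / 4))"
    by simp
  have "(\<integral>\<^sup>+x. ennreal (?g x) \<partial>lborel) =
        (\<integral>\<^sup>+(x :: real ^ 'n). (\<Prod>b\<in>Basis. ennreal (exp (- (x \<bullet> b)\<^sup>2 / 4))) \<partial>lborel)"
    by (subst prod) (simp add: prod_ennreal)
  also have "\<dots> = (\<Prod>b\<in>(Basis :: (real ^ 'n) set). \<integral>\<^sup>+y. ennreal (exp (- y\<^sup>2 / 4)) \<partial>lborel)"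
    by (rule nn_integral_lborel_prod) auto
  also have "\<dots> < \<infinity>"
    using int1 by (simp add: integrable_iff_bounded power_less_top_ennreal)
  finally have "integrable lborel ?g"
    by (intro integrableI_bounded) auto
  hence g: "integrable lborel (\<lambda>x. c * ?g x)" by simp
  have bound: "norm x * exp (- (norm x)\<^sup>2 / 2) \<le> ?g x" for x :: "real ^ 'n"
  proof -
    have "norm x \<le> 1 + (norm x)\<^sup>2 / 4"
      using zero_le_power2[of "1 - norm x / 2"] by (simp add: power2_eq_square algebra_simps)
    also have "\<dots> \<le> exp ((norm x)\<^sup>2 / 4)" by (rule exp_ge_add_one_self)
    finally have "norm x * exp (- (norm x)\<^sup>2 / 2) \<le> exp ((norm x)\<^sup>2 / 4) * exp (- (norm x)\<^sup>2 / 2)"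
      by (rule mult_right_mono) simp
    also have "\<dots> = ?g x" by (simp add: exp_add[symmetric])
    finally show ?thesis .
  qed
  have "integrable lborel (\<lambda>x::real ^ 'n. (c * exp (- (norm x)\<^sup>2 / 2)) *\<^sub>R norm x)"
  proof (rule Bochner_Integration.integrable_bound[OF g])
    show "AE x in lborel. norm ((c * exp (- (norm x)\<^sup>2 / 2)) *\<^sub>R norm x) \<le> norm (c * ?g x)"
      using mult_left_mono[OF bound c] c by (simp add: abs_mult mult_ac)
  qed simp
  thus ?thesis
    unfolding std_gauss_def using c by (simp add: integrable_density c_def)
qed

lemma bdd_above_moment_sum: "bdd_above (range (moment_sum k :: (nat \<Rightarrow> (real ^ 'n) set) \<Rightarrow> real))"
proof -
  let ?M = "LINT x|std_gauss. norm (x :: real ^ 'n)"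
  have le: "norm (LINT x:A|std_gauss. x) \<le> ?M" for A :: "(real ^ 'n) set"
  proof -
    have "norm (LINT x:A|std_gauss. x) \<le> (LINT x|std_gauss. norm (indicator A x *\<^sub>R x))"
      unfolding set_lebesgue_integral_def by (rule integral_norm_bound)
    also have "\<dots> \<le> ?M"
      by (rule integral_mono_AE') (auto simp: integrable_std_gauss_norm split: split_indicator)
    finally show ?thesis .
  qed
  show ?thesis
  proof (rule bdd_aboveI2)
    show "moment_sum k A \<le> (\<Sum>j=1..k. ?M\<^sup>2)" for A :: "nat \<Rightarrow> (real ^ 'n) set"
      unfolding moment_sum_def by (intro sum_mono power_mono le) auto
  qed
qed

end

theory Submission
  imports Defs
begin

text \<open>For a partition with Gaussian moments \<open>z\<^sub>1, \<dots>, z\<^sub>k\<close>, merging parts \<open>i\<close> and \<open>j\<close> changes the sum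
  of squares by \<open>2 (z\<^sub>i \<bullet> z\<^sub>j)\<close>. So in a maximiser with as few nonzero moments as possible the nonzero
  moments have pairwise negative inner products. They also sum to zero, and such vectors satisfy no
  linear relation beyond multiples of this one: \<open>m\<close> of them span a space of dimension \<open>m - 1\<close>, which
  a rotation takes to a coordinate subspace. The cells on which \<open>x \<bullet> z\<^sub>j\<close> is maximal then form another
  maximiser with the same moments, and each is cut out by \<open>m - 1\<close> inequalities with linearly
  independent normals.

  Existence of a maximiser needs no weak compactness. If the moments along a maximising sequence
  converge to \<open>z\<close>, the argmax cells of \<open>z\<close> do at least as well as the limit, because they maximise
  the sum of the \<open>z\<^sub>j \<bullet> w\<^sub>j\<close> over the moments \<open>w\<close> of all partitions.\<close>

section \<open>Gaussian moments of measurable sets and argmax cells\<close>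

definition gauss_moment :: "(real ^ 'n) set \<Rightarrow> real ^ 'n" where
  "gauss_moment A = (LINT x:A|std_gauss. x)"

text \<open>Ties go to the least maximising index, so the cells are disjoint and still cover the
  space even when some vectors coincide. Indices outside \<open>J\<close> get the empty cell, so a
  family indexed by \<open>{1..k}\<close> can have fewer genuine parts.\<close>

definition argmax_cell :: "nat set \<Rightarrow> (nat \<Rightarrow> real ^ 'n) \<Rightarrow> nat \<Rightarrow> (real ^ 'n) set" where
  "argmax_cell J w j =
     {x. j \<in> J \<and> (\<forall>i\<in>J. x \<bullet> w i \<le> x \<bullet> w j \<and> (i < j \<longrightarrow> x \<bullet> w i < x \<bullet> w j))}"

lemma moment_sum_gauss_moment: "moment_sum k A = (\<Sum>j=1..k. (norm (gauss_moment (A j)))\<^sup>2)"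
  by (simp add: moment_sum_def gauss_moment_def)

lemma sets_std_gauss [simp, measurable_cong]: "sets std_gauss = sets borel"
  by (simp add: std_gauss_def)

lemma integrable_std_gauss_id: "integrable std_gauss (\<lambda>x::real ^ 'n. x)"
  by (rule Bochner_Integration.integrable_bound[OF integrable_std_gauss_norm]) auto

lemma set_integrable_std_gauss_id:
  assumes "A \<in> sets borel"
  shows "set_integrable std_gauss A (\<lambda>x::real ^ 'n. x)"
  unfolding set_integrable_def
  by (rule integrable_mult_indicator) (use assms integrable_std_gauss_id in auto)

text \<open>Pairing with a fixed vector turns the vector-valued moment into a scalar integral, in
  which integrands can be compared pointwise.\<close>

lemma inner_gauss_moment:
  fixes w :: "real ^ 'n"
  assumes "A \<in> sets borel"
  shows "w \<bullet> gauss_moment A = (LINT x|std_gauss. indicator A x * (x \<bullet> w))"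
    and "integrable std_gauss (\<lambda>x. indicator A x * (x \<bullet> w))"
proof -
  have i: "integrable std_gauss (\<lambda>x::real ^ 'n. indicator A x *\<^sub>R x)"
    using set_integrable_std_gauss_id[OF assms] by (simp add: set_integrable_def)
  show "integrable std_gauss (\<lambda>x. indicator A x * (x \<bullet> w))"
    using integrable_inner_left[OF i, of w] by simp
  show "w \<bullet> gauss_moment A = (LINT x|std_gauss. indicator A x * (x \<bullet> w))"
    using integral_inner_left[OF i, of w]
    by (simp add: gauss_moment_def set_lebesgue_integral_def inner_commute)
qed

lemma gauss_moment_empty [simp]: "gauss_moment {} = 0"
  by (simp add: gauss_moment_def set_lebesgue_integral_def)

lemma gauss_moment_Un:
  assumes "A \<in> sets borel" "B \<in> sets borel" "A \<inter> B = {}"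
  shows "gauss_moment (A \<union> B) = gauss_moment A + gauss_moment B"
  unfolding gauss_moment_def
  by (rule set_integral_Un) (use assms set_integrable_std_gauss_id in auto)

lemma norm_gauss_moment_le:
  fixes A :: "(real ^ 'n) set"
  shows "norm (gauss_moment A) \<le> (LINT x|std_gauss. norm (x :: real ^ 'n))"
proof -
  have "norm (gauss_moment A) \<le> (LINT x|std_gauss. norm (indicator A x *\<^sub>R x))"
    unfolding gauss_moment_def set_lebesgue_integral_def by (rule integral_norm_bound)
  also have "\<dots> \<le> (LINT x|std_gauss. norm (x :: real ^ 'n))"
    by (rule integral_mono_AE') (auto simp: integrable_std_gauss_norm split: split_indicator)
  finally show ?thesis .
qed

subsection \<open>Existence of an optimal partition\<close>

lemma argmax_cell_ex:
  assumes "finite J" "J \<noteq> {}"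
  shows "\<exists>j\<in>J. x \<in> argmax_cell J w j"
proof -
  define M where "M = Max ((\<lambda>i. x \<bullet> w i) ` J)"
  have le: "x \<bullet> w i \<le> M" if "i \<in> J" for i
    using assms that by (simp add: M_def)
  have "M \<in> (\<lambda>i. x \<bullet> w i) ` J"
    unfolding M_def using assms by (intro Max_in) auto
  then obtain i where i: "i \<in> J \<and> x \<bullet> w i = M" by auto
  \<comment> \<open>Taking the least maximiser provides the strict inequalities against smaller
    indices.\<close>
  define j where "j = (LEAST i. i \<in> J \<and> x \<bullet> w i = M)"
  have j: "j \<in> J \<and> x \<bullet> w j = M"
    unfolding j_def using i by (rule LeastI)
  have "x \<bullet> w i < M" if "i \<in> J" "i < j" for i
    using not_less_Least[of i "\<lambda>i. i \<in> J \<and> x \<bullet> w i = M"] le[of i] that unfolding j_def by force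
  with j le show ?thesis
    by (auto simp: argmax_cell_def)
qed

lemma measurable_partition_argmax_cell:
  fixes w :: "nat \<Rightarrow> real ^ 'n"
  assumes "J \<subseteq> {1..k}" "J \<noteq> {}"
  shows "measurable_partition k (argmax_cell J w)"
proof -
  have fin: "finite J" using assms finite_subset by blast
  have meas: "argmax_cell J w j \<in> sets borel" for j
  proof (cases "j \<in> J")
    case True
    have "argmax_cell J w j =
      (\<Inter>i\<in>J. {x. x \<bullet> w i \<le> x \<bullet> w j \<and> (i < j \<longrightarrow> x \<bullet> w i < x \<bullet> w j)})"
      using True by (auto simp: argmax_cell_def)
    also have "\<dots> \<in> sets borel"
      using fin assms(2) by (intro sets.finite_INT) (auto, measurable)
    finally show ?thesis .
  qed (simp add: argmax_cell_def)
  have "disjoint_family_on (argmax_cell J w) {1..k}"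
    unfolding disjoint_family_on_def argmax_cell_def
    by (auto, metis linorder_neqE_nat not_less)
  moreover have "(\<Union>j\<in>{1..k}. argmax_cell J w j) = UNIV"
    using argmax_cell_ex[OF fin assms(2), of _ w] assms(1) by blast
  ultimately show ?thesis
    using meas by (simp add: measurable_partition_def)
qed

text \<open>Each side is the integral of one function, equal to \<open>x \<bullet> w i\<close> on
  the part with index \<open>i\<close>; the hypothesis \<open>le\<close> compares the two functions
  pointwise. Argmax cells as \<open>B\<close> satisfy it.\<close>

lemma sum_inner_gauss_moment_le:
  fixes w :: "nat \<Rightarrow> real ^ 'n"
  assumes A: "measurable_partition k A" and B: "measurable_partition k B"
    and le: "\<And>x i j. i \<in> {1..k} \<Longrightarrow> j \<in> {1..k} \<Longrightarrow> x \<in> A i \<Longrightarrow> x \<in> B j \<Longrightarrow> x \<bullet> w i \<le> x \<bullet> w j"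
  shows "(\<Sum>j=1..k. w j \<bullet> gauss_moment (A j)) \<le> (\<Sum>j=1..k. w j \<bullet> gauss_moment (B j))"
proof -
  have eq: "(\<Sum>j=1..k. w j \<bullet> gauss_moment (D j)) =
      (LINT x|std_gauss. (\<Sum>j=1..k. indicator (D j) x * (x \<bullet> w j)))"
    and int: "integrable std_gauss (\<lambda>x. \<Sum>j=1..k. indicator (D j) x * (x \<bullet> w j))"
    if "measurable_partition k D" for D
  proof -
    have D: "D j \<in> sets borel" if "j \<in> {1..k}" for j
      using \<open>measurable_partition k D\<close> that by (simp add: measurable_partition_def)
    show "integrable std_gauss (\<lambda>x. \<Sum>j=1..k. indicator (D j) x * (x \<bullet> w j))"
      by (intro Bochner_Integration.integrable_sum inner_gauss_moment(2) D)
    show "(\<Sum>j=1..k. w j \<bullet> gauss_moment (D j)) =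
        (LINT x|std_gauss. (\<Sum>j=1..k. indicator (D j) x * (x \<bullet> w j)))"
      by (subst Bochner_Integration.integral_sum) (simp_all add: inner_gauss_moment D)
  qed
  have single: "(\<Sum>j=1..k. indicator (D j) x * (x \<bullet> w j)) = x \<bullet> w i"
    if "measurable_partition k D" "i \<in> {1..k}" "x \<in> D i" for D i x
  proof -
    have "(\<Sum>j=1..k. indicator (D j) x * (x \<bullet> w j)) = (\<Sum>j=1..k. if j = i then x \<bullet> w i else 0)"
    proof (rule sum.cong)
      fix j assume "j \<in> {1..k}"
      hence "j \<noteq> i \<Longrightarrow> D j \<inter> D i = {}"
        using that unfolding measurable_partition_def disjoint_family_on_def by blast
      thus "indicator (D j) x * (x \<bullet> w j) = (if j = i then x \<bullet> w i else 0)"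
        using that(3) by (auto simp: indicator_def)
    qed simp
    thus ?thesis using that(2) by simp
  qed
  show ?thesis
    unfolding eq[OF A] eq[OF B]
  proof (rule integral_mono[OF int[OF A] int[OF B]])
    fix x
    obtain i where i: "i \<in> {1..k}" "x \<in> A i"
      using A unfolding measurable_partition_def by blast
    obtain j where j: "j \<in> {1..k}" "x \<in> B j"
      using B unfolding measurable_partition_def by blast
    show "(\<Sum>j=1..k. indicator (A j) x * (x \<bullet> w j)) \<le> (\<Sum>j=1..k. indicator (B j) x * (x \<bullet> w j))"
      using single[OF A i] single[OF B j] le[OF i(1) j(1) i(2) j(2)] by simp
  qed
qed

lemma moment_sum_le_kernel_C:
  fixes A :: "nat \<Rightarrow> (real ^ 'n::finite) set"
  assumes "measurable_partition k A"
  shows "moment_sum k A \<le> kernel_C TYPE('n) k"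
  unfolding kernel_C_def
  using assms by (intro cSUP_upper bdd_above_mono[OF bdd_above_moment_sum image_mono[OF subset_UNIV]]) auto

text \<open>Equality case of Cauchy-Schwarz: with \<open>C\<close> the optimum and \<open>z\<close>
  the moments of \<open>B\<close>, the total squared distance between \<open>z\<close> and
  \<open>w\<close> expands to at most \<open>C - 2 * C + C = 0\<close>.\<close>

lemma gauss_moment_eq_if_optimal:
  fixes w :: "nat \<Rightarrow> real ^ 'n::finite"
  assumes B: "measurable_partition k B"
    and w: "(\<Sum>j=1..k. (norm (w j))\<^sup>2) = kernel_C TYPE('n) k"
    and ge: "kernel_C TYPE('n) k \<le> (\<Sum>j=1..k. w j \<bullet> gauss_moment (B j))"
    and j: "j \<in> {1..k}"
  shows "gauss_moment (B j) = w j"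
proof -
  let ?z = "\<lambda>j. gauss_moment (B j)"
  have "(\<Sum>j=1..k. (norm (?z j - w j))\<^sup>2) =
      (\<Sum>j=1..k. (norm (?z j))\<^sup>2) - 2 * (\<Sum>j=1..k. w j \<bullet> ?z j) + (\<Sum>j=1..k. (norm (w j))\<^sup>2)"
    by (simp add: power2_norm_eq_inner inner_diff inner_commute algebra_simps
        sum.distrib sum_subtractf sum_distrib_left)
  also have "\<dots> \<le> 0"
    using moment_sum_le_kernel_C[OF B] w ge by (simp add: moment_sum_gauss_moment)
  finally have "(\<Sum>j=1..k. (norm (?z j - w j))\<^sup>2) = 0"
    by (intro antisym sum_nonneg) auto
  thus ?thesis
    using j by (simp add: sum_nonneg_eq_0_iff)
qed

text \<open>Bolzano-Weierstrass applied to one index at a time, each time refining the subsequence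
  found so far.\<close>

lemma finite_family_convergent_subsequence:
  fixes z :: "nat \<Rightarrow> 'i \<Rightarrow> 'a::euclidean_space"
  assumes "finite K" "\<And>n j. j \<in> K \<Longrightarrow> norm (z n j) \<le> M"
  shows "\<exists>r w. strict_mono (r :: nat \<Rightarrow> nat) \<and> (\<forall>j\<in>K. (\<lambda>n. z (r n) j) \<longlonglongrightarrow> w j)"
  using assms
proof (induction K rule: finite_induct)
  case empty
  then show ?case by (auto intro: exI[of _ id] simp: strict_mono_id)
next
  case (insert i K)
  then obtain r w where r: "strict_mono (r :: nat \<Rightarrow> nat)"
    and w: "\<forall>j\<in>K. (\<lambda>n. z (r n) j) \<longlonglongrightarrow> w j" by auto
  have "bounded (range (\<lambda>n. z (r n) i))"
    using insert.prems by (auto simp: bounded_iff)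
  then obtain l s where s: "strict_mono (s :: nat \<Rightarrow> nat)"
    and l: "((\<lambda>n. z (r n) i) \<circ> s) \<longlonglongrightarrow> l"
    using bounded_imp_convergent_subsequence by blast
  have "(\<lambda>n. z ((r \<circ> s) n) j) \<longlonglongrightarrow> (w(i := l)) j" if "j \<in> insert i K" for j
  proof (cases "j = i")
    case True
    then show ?thesis using l by (simp add: o_def)
  next
    case False
    with that w have "(\<lambda>n. z (r n) j) \<longlonglongrightarrow> w j" by auto
    from LIMSEQ_subseq_LIMSEQ[OF this s] False show ?thesis by (simp add: o_def)
  qed
  with strict_mono_o[OF r s] show ?case by blast
qed

lemma kernel_C_attained:
  assumes k: "k \<ge> 1"
  shows "\<exists>A :: nat \<Rightarrow> (real ^ 'n::finite) set.
           measurable_partition k A \<and> moment_sum k A = kernel_C TYPE('n) k"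
proof -
  let ?C = "kernel_C TYPE('n) k"
  let ?P = "{A :: nat \<Rightarrow> (real ^ 'n) set. measurable_partition k A}"
  have ne: "?P \<noteq> {}"
    using measurable_partition_argmax_cell[of "{1..k}" k] k by fastforce
  \<comment> \<open>A maximising sequence, with explicit gap \<open>1 / Suc n\<close>.\<close>
  have "\<exists>A\<in>?P. ?C - 1 / real (Suc n) < moment_sum k A" for n
    unfolding kernel_C_def
    by (rule less_cSUP_iff[THEN iffD1])
      (use ne bdd_above_mono[OF bdd_above_moment_sum image_mono[OF subset_UNIV]] in auto)
  hence "\<forall>n. \<exists>A :: nat \<Rightarrow> (real ^ 'n) set.
      measurable_partition k A \<and> ?C - 1 / real (Suc n) < moment_sum k A"
    by blast
  from choice[OF this] obtain A :: "nat \<Rightarrow> nat \<Rightarrow> (real ^ 'n) set"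
    where A: "\<And>n. measurable_partition k (A n)"
      and lim: "\<And>n. ?C - 1 / real (Suc n) < moment_sum k (A n)"
    by blast
  obtain r w where r: "strict_mono (r :: nat \<Rightarrow> nat)"
    and w: "\<And>j. j \<in> {1..k} \<Longrightarrow> (\<lambda>n. gauss_moment (A (r n) j)) \<longlonglongrightarrow> w j"
    using finite_family_convergent_subsequence[of "{1..k}" "\<lambda>n j. gauss_moment (A n j)", OF _ norm_gauss_moment_le]
    by (metis finite_atLeastAtMost)
  have "(\<lambda>n. moment_sum k (A n)) \<longlonglongrightarrow> ?C"
  proof (rule tendsto_sandwich)
    show "\<forall>\<^sub>F n in sequentially. ?C - 1 / real (Suc n) \<le> moment_sum k (A n)"
      by (intro always_eventually allI less_imp_le lim)
    show "\<forall>\<^sub>F n in sequentially. moment_sum k (A n) \<le> ?C"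
      by (intro always_eventually allI moment_sum_le_kernel_C A)
    show "(\<lambda>n. ?C - 1 / real (Suc n)) \<longlonglongrightarrow> ?C"
      using tendsto_diff[OF tendsto_const LIMSEQ_inverse_real_of_nat, of ?C]
      by (simp add: inverse_eq_divide)
  qed simp
  from LIMSEQ_subseq_LIMSEQ[OF this r]
  have l1: "(\<lambda>n. moment_sum k (A (r n))) \<longlonglongrightarrow> ?C" by (simp add: o_def)
  have l2: "(\<lambda>n. moment_sum k (A (r n))) \<longlonglongrightarrow> (\<Sum>j=1..k. (norm (w j))\<^sup>2)"
    unfolding moment_sum_gauss_moment by (intro tendsto_intros w)
  have nw: "(\<Sum>j=1..k. (norm (w j))\<^sup>2) = ?C"
    using LIMSEQ_unique[OF l2 l1] .
  define B where "B = argmax_cell {1..k} w"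
  have B: "measurable_partition k B"
    unfolding B_def using k by (intro measurable_partition_argmax_cell) auto
  have "(\<lambda>n. \<Sum>j=1..k. w j \<bullet> gauss_moment (A (r n) j)) \<longlonglongrightarrow> (\<Sum>j=1..k. w j \<bullet> w j)"
    by (intro tendsto_intros w)
  moreover have "(\<Sum>j=1..k. w j \<bullet> gauss_moment (A (r n) j)) \<le> (\<Sum>j=1..k. w j \<bullet> gauss_moment (B j))" for n
    by (rule sum_inner_gauss_moment_le[OF A B]) (auto simp: B_def argmax_cell_def)
  \<comment> \<open>The left side is \<open>?C\<close>, so the argmax cells of the limit vectors
    meet the equality case and have exactly the moments \<open>w\<close>.\<close>
  ultimately have "(\<Sum>j=1..k. w j \<bullet> w j) \<le> (\<Sum>j=1..k. w j \<bullet> gauss_moment (B j))"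
    by (intro LIMSEQ_le_const2) auto
  hence "gauss_moment (B j) = w j" if "j \<in> {1..k}" for j
    using gauss_moment_eq_if_optimal[OF B nw _ that] nw by (simp add: power2_norm_eq_inner)
  hence "moment_sum k B = ?C"
    unfolding moment_sum_gauss_moment nw[symmetric] by (intro sum.cong) auto
  with B show ?thesis by blast
qed

subsection \<open>Obtuse families of moments\<close>

lemma kernel_C_attained_obtuse:
  assumes k: "k \<ge> 1"
  shows "\<exists>A :: nat \<Rightarrow> (real ^ 'n::finite) set.
           measurable_partition k A \<and> moment_sum k A = kernel_C TYPE('n) k \<and>
           (\<forall>i\<in>{1..k}. \<forall>j\<in>{1..k}. i \<noteq> j \<longrightarrow> gauss_moment (A i) \<noteq> 0 \<longrightarrow>
              gauss_moment (A j) \<noteq> 0 \<longrightarrow> gauss_moment (A i) \<bullet> gauss_moment (A j) < 0)"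
proof -
  let ?C = "kernel_C TYPE('n) k"
  define opt where "opt A \<longleftrightarrow> measurable_partition k A \<and> moment_sum k A = ?C"
    for A :: "nat \<Rightarrow> (real ^ 'n) set"
  define supp where "supp A = {j\<in>{1..k}. gauss_moment (A j) \<noteq> 0}"
    for A :: "nat \<Rightarrow> (real ^ 'n) set"
  \<comment> \<open>Among all maximisers, one with the fewest nonzero moments.\<close>
  obtain A where A: "opt A" and min: "\<And>B. opt B \<Longrightarrow> card (supp A) \<le> card (supp B)"
    using ex_has_least_nat[of opt _ "\<lambda>A. card (supp A)"] kernel_C_attained[OF k]
    unfolding opt_def by metis
  have meas: "\<And>j. j \<in> {1..k} \<Longrightarrow> A j \<in> sets borel"
    and disj: "disjoint_family_on A {1..k}" and un: "(\<Union>j\<in>{1..k}. A j) = UNIV"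
    using A by (auto simp: opt_def measurable_partition_def)
  have "gauss_moment (A i) \<bullet> gauss_moment (A j) < 0"
    if ij: "i \<in> {1..k}" "j \<in> {1..k}" "i \<noteq> j"
      and nz: "gauss_moment (A i) \<noteq> 0" "gauss_moment (A j) \<noteq> 0" for i j
  proof (rule ccontr)
    assume "\<not> gauss_moment (A i) \<bullet> gauss_moment (A j) < 0"
    hence nonneg: "gauss_moment (A i) \<bullet> gauss_moment (A j) \<ge> 0" by simp
    \<comment> \<open>Part \<open>j\<close> is absorbed into part \<open>i\<close> and left empty,
      so the index set stays \<open>{1..k}\<close>.\<close>
    define B where "B = A(i := A i \<union> A j, j := {})"
    have B: "measurable_partition k B"
      unfolding measurable_partition_def
    proof (intro conjI)
      show "\<forall>l\<in>{1..k}. B l \<in> sets borel"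
        using meas ij by (auto simp: B_def)
      show "disjoint_family_on B {1..k}"
        unfolding disjoint_family_on_def
      proof (intro ballI impI)
        fix a b assume ab: "a \<in> {1..k}" "b \<in> {1..k}" "a \<noteq> b"
        have "A a \<inter> A b = {}" "A a \<inter> A j = {}" if "a \<noteq> j"
          using disj ab that ij unfolding disjoint_family_on_def by blast+
        moreover have "A b \<inter> A j = {}" if "b \<noteq> j"
          using disj ab that ij unfolding disjoint_family_on_def by blast
        ultimately show "B a \<inter> B b = {}"
          using ab by (auto simp: B_def)
      qed
      have "A l \<subseteq> B (if l = j then i else l)" "(if l = j then i else l) \<in> {1..k}"
        if "l \<in> {1..k}" for l
        using ij that by (auto simp: B_def)
      with un show "(\<Union>l\<in>{1..k}. B l) = UNIV" by blast
    qed
    have Bi: "gauss_moment (B i) = gauss_moment (A i) + gauss_moment (A j)"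
      using disj ij meas unfolding B_def disjoint_family_on_def by (simp add: gauss_moment_Un)
    have Bj: "gauss_moment (B j) = 0"
      by (simp add: B_def)
    have Bl: "gauss_moment (B l) = gauss_moment (A l)" if "l \<noteq> i" "l \<noteq> j" for l
      using that by (simp add: B_def)
    have split: "(\<Sum>l=1..k. f l) = f i + f j + (\<Sum>l\<in>{1..k} - {i, j}. f l)" for f :: "nat \<Rightarrow> real"
      using ij by (subst sum.subset_diff[of "{i, j}"]) auto
    have "moment_sum k B = moment_sum k A + 2 * (gauss_moment (A i) \<bullet> gauss_moment (A j))"
      unfolding moment_sum_gauss_moment split
      by (simp add: Bi Bj Bl power2_norm_eq_inner inner_add inner_commute)
    \<comment> \<open>A nonnegative inner product means that merging loses nothing. The merged
      partition is then also optimal, but has lost the nonzero moment at \<open>j\<close>, against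
      minimality.\<close>
    with moment_sum_le_kernel_C[OF B] nonneg A have "opt B"
      by (simp add: opt_def B)
    moreover have "supp B \<subseteq> supp A - {j}"
      using nz ij Bj Bl unfolding supp_def by force
    hence "card (supp B) \<le> card (supp A - {j})"
      by (intro card_mono) (auto simp: supp_def)
    moreover have "card (supp A - {j}) < card (supp A)"
      using nz ij by (intro card_Diff1_less) (auto simp: supp_def)
    ultimately show False
      using min[of B] by simp
  qed
  with A show ?thesis
    unfolding opt_def by blast
qed

text \<open>Subtracting the least coefficient makes all coefficients nonnegative; pairing with a vector
  whose coefficient vanishes then leaves only nonpositive terms.\<close>

lemma obtuse_dependency_const:
  fixes z :: "'i \<Rightarrow> 'a::real_inner"
  assumes fin: "finite J" and neg: "\<And>i j. i \<in> J \<Longrightarrow> j \<in> J \<Longrightarrow> i \<noteq> j \<Longrightarrow> z i \<bullet> z j < 0"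
    and sum0: "(\<Sum>i\<in>J. z i) = 0" and dep: "(\<Sum>i\<in>J. c i *\<^sub>R z i) = 0"
    and "i \<in> J" "j \<in> J"
  shows "c i = c j"
proof -
  define m where "m = Min (c ` J)"
  have le: "m \<le> c i" if "i \<in> J" for i
    using fin that by (simp add: m_def)
  have "m \<in> c ` J"
    unfolding m_def using fin \<open>i \<in> J\<close> by (intro Min_in) auto
  then obtain l where l: "l \<in> J" "c l = m" by auto
  have "0 = (\<Sum>i\<in>J. (c i - m) *\<^sub>R z i) \<bullet> z l"
    using sum0 dep by (simp add: scaleR_diff_left sum_subtractf scaleR_sum_right[symmetric])
  also have "\<dots> = (\<Sum>i\<in>J. (c i - m) * (z i \<bullet> z l))"
    by (simp add: inner_sum_left)
  finally have eq: "(\<Sum>i\<in>J. - ((c i - m) * (z i \<bullet> z l))) = 0"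
    by (simp add: sum_negf)
  have "c i = m" if i: "i \<in> J" for i
  proof (cases "i = l")
    case False
    have "\<forall>i\<in>J. - ((c i - m) * (z i \<bullet> z l)) = 0"
    proof (rule sum_nonneg_eq_0_iff[OF fin, THEN iffD1, OF _ eq])
      fix i assume "i \<in> J"
      then show "0 \<le> - ((c i - m) * (z i \<bullet> z l))"
        using le[of i] neg[of i l] l
        by (cases "i = l") (auto simp: mult_nonneg_nonpos)
    qed
    then show ?thesis
      using neg[OF i l(1) False] i by force
  qed (simp add: l)
  with assms show ?thesis by simp
qed

text \<open>Passes from independence of an indexed family to independence of its image; injectivity
  is recorded too, since the image alone would hide repetitions.\<close>

lemma independent_image_if_coeffs_zero:
  fixes b :: "'i \<Rightarrow> 'a::real_vector"
  assumes fin: "finite L"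
    and zero: "\<And>c l. (\<Sum>i\<in>L. c i *\<^sub>R b i) = 0 \<Longrightarrow> l \<in> L \<Longrightarrow> c l = 0"
  shows "inj_on b L \<and> independent (b ` L)"
proof
  show inj: "inj_on b L"
  proof (rule inj_onI, rule ccontr)
    fix i j assume ij: "i \<in> L" "j \<in> L" "b i = b j" "i \<noteq> j"
    \<comment> \<open>Two indices with the same vector give the nontrivial relation with
      coefficients 1 and -1.\<close>
    have "(\<Sum>l\<in>L. (if l = i then 1 else if l = j then -1 else 0) *\<^sub>R b l) =
        (\<Sum>l\<in>L. (if l = i then b i else 0) + (if l = j then - b j else 0))"
      using ij by (intro sum.cong) auto
    also have "\<dots> = 0"
      using fin ij by (simp add: sum.distrib)
    finally show False
      using zero[of "\<lambda>l. if l = i then 1 else if l = j then -1 else 0" i] ij by simp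
  qed
  show "independent (b ` L)"
    unfolding dependent_finite[OF finite_imageI[OF fin]]
    using zero[of "\<lambda>l. _ (b l)"] by (auto simp: sum.reindex[OF inj])
qed

text \<open>A relation among the differences is a relation among the \<open>z i\<close> whose
  coefficients add up to zero. By \<open>obtuse_dependency_const\<close> they are all equal, hence
  all zero. The differences serve both to count the dimension of the span and as the normals of a
  cell.\<close>

lemma obtuse_differences_independent:
  fixes z :: "'i \<Rightarrow> 'a::real_inner"
  assumes fin: "finite J" and neg: "\<And>i j. i \<in> J \<Longrightarrow> j \<in> J \<Longrightarrow> i \<noteq> j \<Longrightarrow> z i \<bullet> z j < 0"
    and sum0: "(\<Sum>i\<in>J. z i) = 0" and j: "j \<in> J"
  shows "inj_on (\<lambda>l. z j - z l) (J - {j}) \<and> independent ((\<lambda>l. z j - z l) ` (J - {j}))"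
proof (rule independent_image_if_coeffs_zero)
  show "finite (J - {j})" using fin by simp
  fix c l assume 0: "(\<Sum>i\<in>J - {j}. c i *\<^sub>R (z j - z i)) = 0" and l: "l \<in> J - {j}"
  define s where "s = (\<Sum>i\<in>J - {j}. c i)"
  \<comment> \<open>The coefficients after multiplying out the differences: \<open>z j\<close>
    collects the total \<open>s\<close>, every other vector changes sign.\<close>
  define d where "d i = (if i = j then s else - c i)" for i
  have "(\<Sum>i\<in>J. d i *\<^sub>R z i) = s *\<^sub>R z j + (\<Sum>i\<in>J - {j}. - (c i *\<^sub>R z i))"
    using fin j by (subst sum.remove[of _ j]) (auto simp: d_def intro!: sum.cong)
  also have "\<dots> = 0"
    using 0 by (simp add: s_def scaleR_diff_right sum_subtractf scaleR_sum_left sum_negf)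
  finally have dep: "(\<Sum>i\<in>J. d i *\<^sub>R z i) = 0" .
  have const: "c i = - s" if "i \<in> J - {j}" for i
    using obtuse_dependency_const[OF fin neg sum0 dep _ j, of i] that by (auto simp: d_def)
  have "(\<Sum>i\<in>J - {j}. c i) = (\<Sum>i\<in>J - {j}. - s)"
    using const by (intro sum.cong) auto
  hence "s = - (real (card (J - {j})) * s)"
    by (simp only: s_def[symmetric] sum_constant)
  hence "s * (1 + real (card (J - {j}))) = 0"
    by argo
  hence "s = 0"
    by (simp add: add_nonneg_eq_0_iff)
  with const[OF l] show "c l = 0" by simp
qed

subsection \<open>Rotation invariance\<close>

lemma bounded_linear_orthogonal_transformation:
  fixes f :: "'a::euclidean_space \<Rightarrow> 'a"
  assumes "orthogonal_transformation f"
  shows "bounded_linear f"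
  using orthogonal_transformation_linear[OF assms] by (simp add: linear_conv_bounded_linear)

lemma nn_integral_lborel_translation:
  fixes g :: "'a::euclidean_space \<Rightarrow> ennreal"
  assumes [measurable]: "g \<in> borel_measurable borel"
  shows "(\<integral>\<^sup>+x. g (a + x) \<partial>lborel) = (\<integral>\<^sup>+x. g x \<partial>lborel)"
proof -
  have "(\<integral>\<^sup>+x. g x \<partial>lborel) = (\<integral>\<^sup>+x. g x \<partial>distr lborel borel ((+) a))"
    by (simp add: lborel_distr_plus)
  also have "\<dots> = (\<integral>\<^sup>+x. g (a + x) \<partial>lborel)"
    by (rule nn_integral_distr) measurable
  finally show ?thesis by simp
qed

text \<open>The library proves this only for \<open>real ^ 'n\<close> with a well-ordered index type. The proof is
  the Fubini argument for uniqueness of Haar measure, the two measures being compared on the unit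
  ball.\<close>

lemma distr_lborel_orthogonal_transformation:
  fixes f :: "'a::euclidean_space \<Rightarrow> 'a"
  assumes f: "orthogonal_transformation f"
  shows "distr lborel borel f = lborel"
proof (rule measure_eqI)
  fix A assume "A \<in> sets (distr lborel borel f)"
  hence A [measurable]: "A \<in> sets borel" by simp
  have meas [measurable]: "f \<in> borel_measurable borel"
    using f by (intro borel_measurable_continuous_onI linear_continuous_on
        bounded_linear_orthogonal_transformation)
  define B where "B = ball (0::'a) 1"
  have B [measurable]: "B \<in> sets borel" by (simp add: B_def)
  \<comment> \<open>The ball is invariant under both \<open>f\<close> and negation, which makes it a
    suitable test set.\<close>
  have fB: "- f x \<in> B \<longleftrightarrow> x \<in> B" for x
    using f by (simp add: B_def orthogonal_transformation_norm)
  \<comment> \<open>Evaluated in two orders. Integrating over \<open>y\<close> first gives the image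
    measure of \<open>A\<close> times the volume of \<open>B\<close>; substituting in
    \<open>x\<close> first will give the Lebesgue measure of \<open>A\<close> times the same
    volume.\<close>
  define I where "I = (\<integral>\<^sup>+x. \<integral>\<^sup>+y. indicator A (f x) * indicator B (- f x + y) \<partial>lborel \<partial>lborel)"
  have "(\<integral>\<^sup>+y. indicator B (- f x + y) \<partial>lborel) = emeasure lborel B" for x
    by (subst nn_integral_lborel_translation) simp_all
  hence "I = (\<integral>\<^sup>+x. indicator A (f x) * emeasure lborel B \<partial>lborel)"
    unfolding I_def by (simp add: nn_integral_cmult)
  also have "\<dots> = (\<integral>\<^sup>+x. indicator A x * emeasure lborel B \<partial>distr lborel borel f)"
    by (rule nn_integral_distr[symmetric]) measurable
  also have "\<dots> = emeasure (distr lborel borel f) A * emeasure lborel B"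
    by (simp add: nn_integral_multc)
  finally have 1: "I = emeasure (distr lborel borel f) A * emeasure lborel B" .
  have "I = (\<integral>\<^sup>+y. \<integral>\<^sup>+x. indicator A (f x) * indicator B (- f x + y) \<partial>lborel \<partial>lborel)"
    unfolding I_def by (rule lborel_pair.Fubini'[symmetric]) measurable
  also have "\<dots> = (\<integral>\<^sup>+y. \<integral>\<^sup>+x. indicator A (f x + y) * indicator B x \<partial>lborel \<partial>lborel)"
  proof (rule nn_integral_cong)
    fix y
    \<comment> \<open>The translation of \<open>x\<close> by \<open>inv f y\<close> moves the shift
      \<open>y\<close> from the indicator of \<open>B\<close> to that of \<open>A\<close>.\<close>
    have "f (inv f y + x) = f x + y" for x
      using f by (simp add: linear_add orthogonal_transformation_linear
          orthogonal_transformation_surj surj_f_inv_f)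
    hence "(\<integral>\<^sup>+x. indicator A (f x + y) * indicator B (- f x) \<partial>lborel) =
        (\<integral>\<^sup>+x. indicator A (f x) * indicator B (- f x + y) \<partial>lborel)"
      using nn_integral_lborel_translation[of "\<lambda>x. indicator A (f x) * indicator B (- f x + y)" "inv f y"]
      by simp
    moreover have "indicator B (- f x) = (indicator B x :: ennreal)" for x
      using fB by (simp add: indicator_def)
    ultimately show "(\<integral>\<^sup>+x. indicator A (f x) * indicator B (- f x + y) \<partial>lborel) =
        (\<integral>\<^sup>+x. indicator A (f x + y) * indicator B x \<partial>lborel)"
      by simp
  qed
  also have "\<dots> = (\<integral>\<^sup>+x. \<integral>\<^sup>+y. indicator A (f x + y) * indicator B x \<partial>lborel \<partial>lborel)"
    by (rule lborel_pair.Fubini') measurable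
  also have "\<dots> = (\<integral>\<^sup>+x. emeasure lborel A * indicator B x \<partial>lborel)"
  proof (rule nn_integral_cong)
    fix x
    have "(\<integral>\<^sup>+y. indicator A (f x + y) \<partial>lborel) = emeasure lborel A"
      by (subst nn_integral_lborel_translation) simp_all
    thus "(\<integral>\<^sup>+y. indicator A (f x + y) * indicator B x \<partial>lborel) = emeasure lborel A * indicator B x"
      by (simp add: nn_integral_multc)
  qed
  also have "\<dots> = emeasure lborel A * emeasure lborel B"
    by (simp add: nn_integral_cmult)
  finally have "emeasure lborel B * emeasure (distr lborel borel f) A = emeasure lborel B * emeasure lborel A"
    using 1 by (simp add: mult.commute)
  \<comment> \<open>The common factor can be cancelled once it is known to be nonzero and
    finite.\<close>
  moreover have "emeasure lborel B \<noteq> 0"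
  proof
    assume "emeasure lborel B = 0"
    hence "negligible B"
      by (simp add: negligible_iff_null_sets null_sets_def)
    thus False
      using open_not_negligible[of B] by (simp add: B_def)
  qed
  moreover have "emeasure lborel B < \<top>"
    using emeasure_lborel_ball_finite[of "0::'a" 1] by (simp add: B_def)
  ultimately show "emeasure (distr lborel borel f) A = emeasure lborel A"
    by (auto simp: ennreal_mult_cancel_left)
qed simp

text \<open>Lebesgue measure is invariant under \<open>f\<close>, and the Gaussian density depends
  only on the norm.\<close>

lemma distr_std_gauss_orthogonal_transformation:
  fixes f :: "real ^ 'n \<Rightarrow> real ^ 'n"
  assumes f: "orthogonal_transformation f"
  shows "distr std_gauss borel f = std_gauss"
proof -
  let ?\<phi> = "\<lambda>x::real ^ 'n. ennreal ((2 * pi) powr (- (real CARD('n) / 2)) * exp (- (norm x)\<^sup>2 / 2))"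
  have meas: "f \<in> borel_measurable borel"
    using f by (intro borel_measurable_continuous_onI linear_continuous_on bounded_linear_orthogonal_transformation)
  have "distr (density lborel (\<lambda>x. ?\<phi> (f x))) borel f = density (distr lborel borel f) ?\<phi>"
    by (rule density_distr[symmetric]) (use meas in auto)
  thus ?thesis
    using f by (simp add: std_gauss_def distr_lborel_orthogonal_transformation
        orthogonal_transformation_norm)
qed

text \<open>Change of variables in the invariant measure, after which the linear map
  \<open>f\<close> is pulled out of the integral. Working with preimages makes measurability
  immediate.\<close>

lemma gauss_moment_vimage:
  fixes f :: "real ^ 'n \<Rightarrow> real ^ 'n"
  assumes f: "orthogonal_transformation f" and A: "A \<in> sets borel"
  shows "f (gauss_moment (f -` A)) = gauss_moment A" and "f -` A \<in> sets borel"
proof -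
  have bl: "bounded_linear f"
    using f by (rule bounded_linear_orthogonal_transformation)
  hence meas: "f \<in> borel_measurable borel"
    by (simp add: borel_measurable_continuous_onI linear_continuous_on)
  show sets: "f -` A \<in> sets borel"
    using measurable_sets_borel[OF meas A] by simp
  have int: "integrable std_gauss (\<lambda>x. indicator (f -` A) x *\<^sub>R x)"
    using set_integrable_std_gauss_id[OF sets] by (simp add: set_integrable_def)
  have "gauss_moment A = (LINT x|distr std_gauss borel f. indicator A x *\<^sub>R x)"
    by (simp add: gauss_moment_def set_lebesgue_integral_def
        distr_std_gauss_orthogonal_transformation[OF f])
  also have "\<dots> = (LINT x|std_gauss. indicator A (f x) *\<^sub>R f x)"
    by (rule integral_distr) (use meas A in measurable)
  also have "\<dots> = (LINT x|std_gauss. f (indicator (f -` A) x *\<^sub>R x))"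
    by (intro Bochner_Integration.integral_cong)
      (simp_all add: linear_simps(5)[OF bl] indicator_def)
  also have "\<dots> = f (gauss_moment (f -` A))"
    using integral_bounded_linear[OF bl int]
    by (simp add: gauss_moment_def set_lebesgue_integral_def)
  finally show "f (gauss_moment (f -` A)) = gauss_moment A" by simp
qed

section \<open>The total moment and positivity of the optimum\<close>

lemma gauss_moment_UNIV: "gauss_moment (UNIV :: (real ^ 'n) set) = 0"
proof -
  have "orthogonal_transformation (uminus :: real ^ 'n \<Rightarrow> real ^ 'n)"
    by (simp add: orthogonal_transformation_def linear_uminus)
  \<comment> \<open>The reflection at the origin shows that the moment equals its own
    negative.\<close>
  from gauss_moment_vimage(1)[OF this, of UNIV] show ?thesis
    by (simp add: vec_eq_iff)
qed

lemma sum_gauss_moment_eq_0: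
  fixes A :: "nat \<Rightarrow> (real ^ 'n) set"
  assumes A: "measurable_partition k A"
  shows "(\<Sum>j=1..k. gauss_moment (A j)) = 0"
proof -
  have "gauss_moment (\<Union>j\<in>K. A j) = (\<Sum>j\<in>K. gauss_moment (A j))" if "K \<subseteq> {1..k}" for K
    using finite_subset[OF that finite_atLeastAtMost] that
  proof (induction K rule: finite_induct)
    case (insert i K)
    have "disjoint_family_on A {1..k}" and meas: "\<And>j. j \<in> {1..k} \<Longrightarrow> A j \<in> sets borel"
      using A by (auto simp: measurable_partition_def)
    hence "A i \<inter> A j = {}" if "j \<in> K" for j
      using insert.hyps insert.prems that unfolding disjoint_family_on_def by (metis insert_subset subsetD)
    hence "A i \<inter> (\<Union>j\<in>K. A j) = {}" by auto
    moreover have "(\<Union>j\<in>K. A j) \<in> sets borel" "A i \<in> sets borel"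
      using meas insert.hyps insert.prems by (auto intro!: sets.finite_UN)
    ultimately show ?case
      using insert by (simp add: gauss_moment_Un)
  qed simp
  from this[of "{1..k}"] A show ?thesis
    by (metis gauss_moment_UNIV measurable_partition_def order_refl)
qed

text \<open>A half-space and its complement already give a positive value. This ensures that a
  maximiser has a nonzero moment.\<close>

lemma kernel_C_pos:
  assumes k: "k \<ge> 2"
  shows "kernel_C TYPE('n::finite) k > 0"
proof -
  fix i :: 'n
  define H where "H = {x :: real ^ 'n. x $ i > 0}"
  have op: "open H"
    unfolding H_def by (rule open_halfspace_component_gt_cart)
  hence sets: "H \<in> sets borel" by simp
  define A where "A j = (if j = (1::nat) then H else if j = 2 then - H else {})" for j
  have A: "measurable_partition k A"
    using k sets unfolding measurable_partition_def disjoint_family_on_def A_def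
    by (auto intro!: bexI[of _ 1] bexI[of _ 2])
  have "gauss_moment H \<noteq> 0"
  proof
    assume "gauss_moment H = 0"
    \<comment> \<open>Along the normal of the half-space the integrand is nonnegative, and positive
      on all of \<open>H\<close>. A vanishing integral would make the nonempty open set
      \<open>H\<close> null.\<close>
    hence "(LINT x|std_gauss. indicator H x * (x \<bullet> axis i 1)) = 0"
      using inner_gauss_moment(1)[OF sets, of "axis i 1"] by simp
    moreover have "AE x in std_gauss. 0 \<le> indicator H x * (x \<bullet> axis i 1)"
      by (auto simp: H_def inner_axis indicator_def)
    ultimately have "AE x in std_gauss. indicator H x * (x \<bullet> axis i 1) = 0"
      using integral_nonneg_eq_0_iff_AE[OF inner_gauss_moment(2)[OF sets]] by blast
    hence "AE x in lborel. x \<notin> H"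
      unfolding std_gauss_def by (subst (asm) AE_density) (auto simp: H_def inner_axis)
    hence "H \<in> null_sets lborel"
      using sets by (simp add: AE_iff_null_sets)
    hence "negligible H"
      by (simp add: negligible_iff_null_sets null_sets_completionI)
    moreover have "axis i 1 \<in> H"
      by (simp add: H_def)
    ultimately show False
      using op open_not_negligible by blast
  qed
  hence "0 < (norm (gauss_moment (A 1)))\<^sup>2"
    by (simp add: A_def)
  also have "\<dots> \<le> moment_sum k A"
    unfolding moment_sum_gauss_moment using k by (intro member_le_sum) auto
  also have "\<dots> \<le> kernel_C TYPE('n) k"
    by (rule moment_sum_le_kernel_C[OF A])
  finally show ?thesis .
qed

subsection \<open>Simplicial cones\<close>

text \<open>The functional that is 1 at \<open>b l\<close> and 0 at the other basis vectors is
  represented by \<open>adjoint g 1\<close>; its projection to \<open>V\<close> is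
  \<open>u l\<close>. The \<open>u l\<close> will generate the extreme rays of the cone with normals
  \<open>b l\<close>.\<close>

lemma dual_basis_exists:
  fixes b :: "'i \<Rightarrow> 'a::euclidean_space"
  assumes V: "subspace V" and fin: "finite L" and inj: "inj_on b L" and ind: "independent (b ` L)"
    and sub: "b ` L \<subseteq> V" and dim: "dim V = card L"
  obtains u where "\<And>l. l \<in> L \<Longrightarrow> u l \<in> V"
    and "\<And>l m. l \<in> L \<Longrightarrow> m \<in> L \<Longrightarrow> u l \<bullet> b m = (if l = m then 1 else 0)"
    and "\<And>x. x \<in> V \<Longrightarrow> x = (\<Sum>l\<in>L. (x \<bullet> b l) *\<^sub>R u l)"
proof -
  have "\<exists>u\<in>V. \<forall>m\<in>L. u \<bullet> b m = (if l = m then 1 else 0)" if l: "l \<in> L" for l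
  proof -
    obtain g :: "'a \<Rightarrow> real" where g: "linear g"
      and gb: "\<forall>x\<in>b ` L. g x = (if x = b l then 1 else 0)"
      using linear_independent_extend[OF ind, of "\<lambda>x. if x = b l then 1 else 0"] by blast
    obtain y z where y: "y \<in> span V" and z: "\<And>w. w \<in> span V \<Longrightarrow> orthogonal z w"
      and yz: "adjoint g 1 = y + z"
      using orthogonal_subspace_decomp_exists[of V "adjoint g 1"] by blast
    have "y \<bullet> b m = (if l = m then 1 else 0)" if m: "m \<in> L" for m
    proof -
      have "z \<bullet> b m = 0"
        using z[of "b m"] m sub by (auto simp: orthogonal_def intro: span_base)
      hence "y \<bullet> b m = b m \<bullet> adjoint g 1"
        by (simp add: yz inner_add_left inner_commute[of "b m"])
      also have "\<dots> = g (b m)"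
        by (simp add: adjoint_works[OF g])
      finally show ?thesis
        using gb m l inj by (auto simp: inj_on_eq_iff)
    qed
    moreover have "y \<in> V"
      using y V by (simp only: span_eq_iff[THEN iffD2])
    ultimately show ?thesis by blast
  qed
  then obtain u where uV: "\<And>l. l \<in> L \<Longrightarrow> u l \<in> V"
    and ub: "\<And>l m. l \<in> L \<Longrightarrow> m \<in> L \<Longrightarrow> u l \<bullet> b m = (if l = m then 1 else 0)"
    by metis
  have "x = (\<Sum>l\<in>L. (x \<bullet> b l) *\<^sub>R u l)" if x: "x \<in> V" for x
  proof -
    define y where "y = x - (\<Sum>l\<in>L. (x \<bullet> b l) *\<^sub>R u l)"
    \<comment> \<open>Equal dimension makes the \<open>b l\<close> span \<open>V\<close>. The
      remainder \<open>y\<close> is orthogonal to all of them and lies in their span, so it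
      vanishes.\<close>
    have "V \<subseteq> span (b ` L)"
      using card_eq_dim[OF sub, THEN iffD1] ind dim fin by (simp add: card_image[OF inj])
    moreover have "y \<in> V"
      unfolding y_def using V x uV by (intro subspace_diff subspace_sum subspace_scale) auto
    ultimately have "y \<in> span (b ` L)" by blast
    moreover have "orthogonal y w" if w: "w \<in> b ` L" for w
    proof -
      obtain m where m: "m \<in> L" "w = b m" using w by blast
      have "(\<Sum>l\<in>L. (x \<bullet> b l) * (u l \<bullet> b m)) = (\<Sum>l\<in>L. if l = m then x \<bullet> b m else 0)"
        using ub m by (intro sum.cong) auto
      thus ?thesis
        using m fin by (simp add: orthogonal_def y_def inner_diff_left inner_sum_left)
    qed
    ultimately have "orthogonal y y"
      using orthogonal_to_span by blast
    thus ?thesis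
      by (simp add: orthogonal_def y_def)
  qed
  with uV ub that show ?thesis by blast
qed

text \<open>In the coordinates \<open>x \<bullet> b l\<close> the set is a nonnegative orthant with
  the faces selected by \<open>P\<close> removed. Its base is the slice where the coordinates sum to
  1, a simplex with the dual vectors \<open>u l\<close> as vertices. In use, \<open>P\<close>
  encodes the tie-breaking.\<close>

lemma simplicial_cone_orthant:
  fixes b :: "'i \<Rightarrow> 'a::euclidean_space"
  assumes V: "subspace V" and fin: "finite L" and inj: "inj_on b L" and ind: "independent (b ` L)"
    and sub: "b ` L \<subseteq> V" and dim: "dim V = card L"
  shows "simplicial_cone (card L) {x\<in>V. \<forall>l\<in>L. 0 \<le> x \<bullet> b l \<and> (P l \<longrightarrow> 0 < x \<bullet> b l)}"
    (is "simplicial_cone _ ?B")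
proof -
  obtain u where uV: "\<And>l. l \<in> L \<Longrightarrow> u l \<in> V"
    and ub: "\<And>l m. l \<in> L \<Longrightarrow> m \<in> L \<Longrightarrow> u l \<bullet> b m = (if l = m then 1 else 0)"
    and expand: "\<And>x. x \<in> V \<Longrightarrow> x = (\<Sum>l\<in>L. (x \<bullet> b l) *\<^sub>R u l)"
    using dual_basis_exists[OF assms] by blast
  have coord: "(\<Sum>i\<in>L. c i *\<^sub>R u i) \<bullet> b l = c l" if l: "l \<in> L" for c l
  proof -
    have "(\<Sum>i\<in>L. c i *\<^sub>R u i) \<bullet> b l = (\<Sum>i\<in>L. if i = l then c l else 0)"
      unfolding inner_sum_left using ub l by (intro sum.cong) auto
    thus ?thesis using fin l by simp
  qed
  have u: "inj_on u L" "independent (u ` L)"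
    using independent_image_if_coeffs_zero[OF fin, of u] coord by (metis inner_zero_left)+
  \<comment> \<open>Barycentric coordinates with respect to the \<open>u l\<close> are the inner
    products with the \<open>b l\<close>. Taking \<open>Q\<close> as nonnegative, positive or always
    true describes the simplex, its relative interior and its affine hull.\<close>
  have bary: "(\<exists>c. (\<forall>x\<in>u ` L. Q (c x)) \<and> sum c (u ` L) = 1 \<and> (\<Sum>x\<in>u ` L. c x *\<^sub>R x) = y) \<longleftrightarrow>
      y \<in> V \<and> (\<forall>l\<in>L. Q (y \<bullet> b l)) \<and> (\<Sum>l\<in>L. y \<bullet> b l) = 1" for Q :: "real \<Rightarrow> bool" and y
  proof
    assume "\<exists>c. (\<forall>x\<in>u ` L. Q (c x)) \<and> sum c (u ` L) = 1 \<and> (\<Sum>x\<in>u ` L. c x *\<^sub>R x) = y"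
    then obtain c where c: "\<forall>l\<in>L. Q (c (u l))" "(\<Sum>l\<in>L. c (u l)) = 1"
      and y: "y = (\<Sum>l\<in>L. c (u l) *\<^sub>R u l)"
      by (auto simp: sum.reindex[OF u(1)])
    have "y \<in> V"
      unfolding y using V uV by (intro subspace_sum subspace_scale) auto
    moreover have "y \<bullet> b l = c (u l)" if "l \<in> L" for l
      unfolding y by (rule coord[OF that])
    ultimately show "y \<in> V \<and> (\<forall>l\<in>L. Q (y \<bullet> b l)) \<and> (\<Sum>l\<in>L. y \<bullet> b l) = 1"
      using c by simp
  next
    assume y: "y \<in> V \<and> (\<forall>l\<in>L. Q (y \<bullet> b l)) \<and> (\<Sum>l\<in>L. y \<bullet> b l) = 1"
    define c where "c x = y \<bullet> b (inv_into L u x)" for x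
    have "c (u l) = y \<bullet> b l" if "l \<in> L" for l
      using u(1) that by (simp add: c_def)
    with y expand[of y]
    show "\<exists>c. (\<forall>x\<in>u ` L. Q (c x)) \<and> sum c (u ` L) = 1 \<and> (\<Sum>x\<in>u ` L. c x *\<^sub>R x) = y"
      by (intro exI[of _ c]) (simp add: sum.reindex[OF u(1)])
  qed
  define S where "S = convex hull (u ` L)"
  define T where "T = {y \<in> ?B. (\<Sum>l\<in>L. y \<bullet> b l) = 1}"
  have aff: "\<not> affine_dependent (u ` L)"
    using u(2) affine_dependent_imp_dependent by blast
  have S: "S = {y\<in>V. (\<forall>l\<in>L. 0 \<le> y \<bullet> b l) \<and> (\<Sum>l\<in>L. y \<bullet> b l) = 1}"
    unfolding S_def convex_hull_finite[OF finite_imageI[OF fin]] using bary[of "\<lambda>c. 0 \<le> c"] by auto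
  have rel: "rel_interior S = {y\<in>V. (\<forall>l\<in>L. 0 < y \<bullet> b l) \<and> (\<Sum>l\<in>L. y \<bullet> b l) = 1}"
    unfolding S_def rel_interior_convex_hull_explicit[OF aff] using bary[of "\<lambda>c. 0 < c"] by auto
  have hull: "affine hull S = {y\<in>V. (\<Sum>l\<in>L. y \<bullet> b l) = 1}"
    unfolding S_def affine_hull_convex_hull affine_hull_finite[OF finite_imageI[OF fin]]
    using bary[of "\<lambda>_. True"] by auto
  show ?thesis
    unfolding simplicial_cone_def
  proof (intro exI conjI)
    show "(int (card L) - 1) simplex S"
      unfolding S_def by (rule simplex_convex_hull) (use aff in \<open>simp_all add: card_image[OF u(1)]\<close>)
    show "0 \<notin> affine hull S" by (simp add: hull)
    show "rel_interior S \<subseteq> T" by (auto simp: rel T_def less_imp_le)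
    show "T \<subseteq> S" by (auto simp: S T_def)
    show "?B - {0} = {t *\<^sub>R x |t x. 0 < t \<and> x \<in> T}"
    proof (intro equalityI subsetI)
      fix x assume x: "x \<in> ?B - {0}"
      \<comment> \<open>The factor that scales \<open>x\<close> onto the slice; if it were zero, all
        coordinates and hence \<open>x\<close> would vanish.\<close>
      define s where "s = (\<Sum>l\<in>L. x \<bullet> b l)"
      have nn: "0 \<le> x \<bullet> b l" if "l \<in> L" for l using x that by auto
      have "s \<noteq> 0"
      proof
        assume "s = 0"
        hence "\<forall>l\<in>L. x \<bullet> b l = 0"
          using sum_nonneg_eq_0_iff[OF fin, of "\<lambda>l. x \<bullet> b l"] nn by (simp add: s_def)
        with expand[of x] x show False by simp
      qed
      hence s: "0 < s"
        using sum_nonneg[of L "\<lambda>l. x \<bullet> b l"] nn by (simp add: s_def order.strict_iff_order)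
      have "inverse s *\<^sub>R x \<in> T"
        unfolding T_def using x s V
        by (auto simp: subspace_scale sum_distrib_left[symmetric] s_def[symmetric])
      moreover have "x = s *\<^sub>R (inverse s *\<^sub>R x)"
        using s by simp
      ultimately show "x \<in> {t *\<^sub>R x |t x. 0 < t \<and> x \<in> T}"
        using s by blast
    next
      fix y assume "y \<in> {t *\<^sub>R x |t x. 0 < t \<and> x \<in> T}"
      then obtain t x where t: "0 < t" and x: "x \<in> T" and y: "y = t *\<^sub>R x" by blast
      have "x \<noteq> 0" using x by (auto simp: T_def)
      with t x y V show "y \<in> ?B - {0}"
        by (auto simp: T_def subspace_scale)
    qed
  qed
qed

section \<open>Coordinate subspaces and rotation into them\<close>

lemma dim_coord_subspace: "dim (coord_subspace I) = card I"
  using dim_substandard_cart[of I, where 'a = real] by (simp add: coord_subspace_def dim_vec_eq)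

lemma subspace_coord_subspace: "subspace (coord_subspace I)"
  by (simp add: coord_subspace_def subspace_def)

lemma inner_coord_proj:
  assumes "y \<in> coord_subspace I"
  shows "coord_proj I x \<bullet> y = x \<bullet> y"
  unfolding inner_vec_def using assms
  by (intro sum.cong) (auto simp: coord_proj_def coord_subspace_def)

lemma coord_proj_in_coord_subspace: "coord_proj I x \<in> coord_subspace I"
  by (simp add: coord_proj_def coord_subspace_def)

text \<open>Orthonormal bases of \<open>U\<close> and of its orthogonal complement together form the
  rows of an orthogonal matrix. \<open>I\<close> collects the rows taken from \<open>U\<close>; all
  other rows annihilate \<open>U\<close>.\<close>

lemma orthogonal_transformation_onto_coord_subspace:
  fixes U :: "(real ^ 'n) set"
  assumes U: "subspace U"
  obtains f :: "real ^ 'n \<Rightarrow> real ^ 'n" and I :: "'n set"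
  where "orthogonal_transformation f" "card I = dim U" "f ` U \<subseteq> coord_subspace I"
proof -
  define U' where "U' = {y. \<forall>x\<in>U. orthogonal x y}"
  have U': "subspace U'"
    unfolding U'_def by (rule subspace_orthogonal_to_vectors)
  have dim: "dim U' + dim U = CARD('n)"
    using dim_subspace_orthogonal_to_vectors[OF U subspace_UNIV] by (simp add: U'_def)
  obtain B where B: "B \<subseteq> U" "pairwise orthogonal B" "\<And>x. x \<in> B \<Longrightarrow> norm x = 1"
    "independent B" "card B = dim U"
    using orthonormal_basis_subspace[OF U] by metis
  obtain B' where B': "B' \<subseteq> U'" "pairwise orthogonal B'" "\<And>x. x \<in> B' \<Longrightarrow> norm x = 1"
    "independent B'" "card B' = dim U'"
    using orthonormal_basis_subspace[OF U'] by metis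
  have cross: "orthogonal x y" if "x \<in> U" "y \<in> U'" for x y
    using that by (simp add: U'_def)
  have disj: "B \<inter> B' = {}"
    using B(1,3) B'(1) cross by (force simp: orthogonal_self)
  have fin: "finite B" "finite B'"
    using B(4) B'(4) independent_imp_finite by blast+
  have "card (UNIV :: 'n set) = card (B \<union> B')"
    using dim B(5) B'(5) by (simp add: card_Un_disjoint[OF fin disj])
  then obtain e where e: "bij_betw e (UNIV :: 'n set) (B \<union> B')"
    using finite_same_card_bij[of "UNIV :: 'n set" "B \<union> B'"] fin by auto
  define I where "I = e -` B"
  define A where "A = (\<chi> i. e i)"
  have row: "row i A = e i" for i
    by (simp add: row_def A_def)
  have "orthogonal (e i) (e j)" if "i \<noteq> j" for i j
  proof -
    have "e i \<noteq> e j" "e i \<in> B \<union> B'" "e j \<in> B \<union> B'"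
      using e that by (auto simp: bij_betw_def inj_on_eq_iff)
    thus ?thesis
      using B(1,2) B'(1,2) cross that unfolding pairwise_def by (metis UnE orthogonal_commute subsetD)
  qed
  moreover have "norm (e i) = 1" for i
    using bij_betwE[OF e] B(3) B'(3) by auto
  ultimately have "orthogonal_matrix A"
    by (simp add: orthogonal_matrix_orthonormal_rows row)
  hence "orthogonal_transformation ((*v) A)"
    by (simp add: orthogonal_transformation_matrix)
  moreover have "e ` I = B"
    using e by (auto simp: I_def bij_betw_def)
  hence "card I = dim U"
    using e B(5) card_image[of e I] by (metis bij_betw_def inj_on_subset subset_UNIV)
  moreover have "(*v) A ` U \<subseteq> coord_subspace I"
  proof -
    have "e i \<in> U'" if "i \<notin> I" for i
      using bij_betwE[OF e] that B'(1) by (auto simp: I_def)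
    thus ?thesis
      using cross by (auto simp: coord_subspace_def matrix_vector_mul_component A_def
          orthogonal_def inner_commute)
  qed
  ultimately show ?thesis
    using that by blast
qed

text \<open>Rotates an obtuse maximiser: \<open>card J\<close> obtuse moments with sum zero lie in a
  subspace of dimension \<open>card J - 1\<close>, and rotation preserves norms and inner products
  of moments.\<close>

lemma kernel_C_attained_in_coord_subspace:
  assumes k: "k \<ge> 2"
  obtains A :: "nat \<Rightarrow> (real ^ 'n) set" and J :: "nat set" and I :: "'n set" where
    "measurable_partition k A" "moment_sum k A = kernel_C TYPE('n) k"
    "J = {j\<in>{1..k}. gauss_moment (A j) \<noteq> 0}" "J \<noteq> {}"
    "\<And>i j. i \<in> J \<Longrightarrow> j \<in> J \<Longrightarrow> i \<noteq> j \<Longrightarrow> gauss_moment (A i) \<bullet> gauss_moment (A j) < 0"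
    "card I + 1 = card J" "\<And>j. j \<in> J \<Longrightarrow> gauss_moment (A j) \<in> coord_subspace I"
proof -
  obtain A :: "nat \<Rightarrow> (real ^ 'n) set" where A: "measurable_partition k A"
    and opt: "moment_sum k A = kernel_C TYPE('n) k"
    and obt: "\<And>i j. i \<in> {1..k} \<Longrightarrow> j \<in> {1..k} \<Longrightarrow> i \<noteq> j \<Longrightarrow> gauss_moment (A i) \<noteq> 0 \<Longrightarrow>
        gauss_moment (A j) \<noteq> 0 \<Longrightarrow> gauss_moment (A i) \<bullet> gauss_moment (A j) < 0"
    using kernel_C_attained_obtuse[of k, where 'n = 'n] k by auto
  define z where "z j = gauss_moment (A j)" for j
  define J where "J = {j\<in>{1..k}. z j \<noteq> 0}"
  have fin: "finite J" by (simp add: J_def)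
  have neg: "z i \<bullet> z j < 0" if "i \<in> J" "j \<in> J" "i \<noteq> j" for i j
    using obt that by (simp add: J_def z_def)
  have "J \<noteq> {}"
  proof
    assume "J = {}"
    hence "moment_sum k A = 0"
      unfolding moment_sum_gauss_moment by (intro sum.neutral) (auto simp: J_def z_def)
    with opt kernel_C_pos[OF k, where 'n = 'n] show False by simp
  qed
  then obtain j where j: "j \<in> J" by blast
  have sum0: "(\<Sum>j\<in>J. z j) = 0"
  proof -
    have "(\<Sum>j=1..k. z j) = (\<Sum>j\<in>J. z j)"
      by (rule sum.mono_neutral_right) (auto simp: J_def)
    thus ?thesis using sum_gauss_moment_eq_0[OF A] by (simp add: z_def)
  qed
  define b where "b l = z j - z l" for l
  define U where "U = span (b ` (J - {j}))"
  have "inj_on b (J - {j})" "independent (b ` (J - {j}))"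
    unfolding b_def using obtuse_differences_independent[OF fin neg sum0 j] by auto
  hence "dim U = card (J - {j})"
    unfolding U_def by (metis dim_span dim_eq_card_independent card_image)
  hence dim: "dim U + 1 = card J"
    using card.remove[OF fin j] by linarith
  have bU: "b l \<in> U" if "l \<in> J" for l
  proof (cases "l = j")
    case True
    then show ?thesis by (simp add: b_def U_def span_zero)
  next
    case False
    with that show ?thesis unfolding U_def by (intro span_base) auto
  qed
  \<comment> \<open>Since the moments sum to zero, adding up the differences isolates a multiple of
    \<open>z j\<close>. So the span of the differences contains the moments themselves.\<close>
  have "(\<Sum>l\<in>J. b l) = real (card J) *\<^sub>R z j"
    by (simp add: b_def sum_subtractf sum0 scaleR_conv_of_real)
  moreover have "(\<Sum>l\<in>J. b l) \<in> U"
    unfolding U_def by (rule span_sum) (use bU in \<open>simp add: U_def\<close>)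
  ultimately have "inverse (real (card J)) *\<^sub>R (real (card J) *\<^sub>R z j) \<in> U"
    unfolding U_def by (metis span_scale)
  moreover have "real (card J) \<noteq> 0"
    using fin j by auto
  ultimately have zj: "z j \<in> U"
    by simp
  have U: "subspace U"
    unfolding U_def by (rule subspace_span)
  have zU: "z l \<in> U" if "l \<in> J" for l
    using subspace_diff[OF U zj bU[OF that]] by (simp add: b_def)
  obtain f :: "real ^ 'n \<Rightarrow> real ^ 'n" and I :: "'n set"
    where f: "orthogonal_transformation f" and I: "card I = dim U"
    and fU: "f ` U \<subseteq> coord_subspace I"
    by (rule orthogonal_transformation_onto_coord_subspace[OF U])
  have g: "orthogonal_transformation (inv f)"
    using f by (rule orthogonal_transformation_inv)
  \<comment> \<open>The preimage under \<open>inv f\<close> is the image under \<open>f\<close>, so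
    the moments are moved by \<open>f\<close>.\<close>
  define A' where "A' j = inv f -` A j" for j
  have meas: "A j \<in> sets borel" if "j \<in> {1..k}" for j
    using A that by (simp add: measurable_partition_def)
  have mom: "gauss_moment (A' j) = f (z j)" if "j \<in> {1..k}" for j
    using gauss_moment_vimage(1)[OF g meas[OF that]] f
    by (metis A'_def z_def orthogonal_transformation_surj surj_f_inv_f)
  have nf: "norm (f x) = norm x" "f x \<bullet> f y = x \<bullet> y" for x y
    using f by (simp_all add: orthogonal_transformation_norm orthogonal_transformation_def)
  show ?thesis
  proof (rule that)
    show "measurable_partition k A'"
      unfolding measurable_partition_def
    proof (intro conjI)
      show "\<forall>j\<in>{1..k}. A' j \<in> sets borel"
        using gauss_moment_vimage(2)[OF g meas] by (simp add: A'_def)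
      show "disjoint_family_on A' {1..k}"
        using A unfolding measurable_partition_def disjoint_family_on_def A'_def by blast
      show "(\<Union>j\<in>{1..k}. A' j) = UNIV"
        using A unfolding measurable_partition_def A'_def by (metis vimage_UN vimage_UNIV)
    qed
    show "moment_sum k A' = kernel_C TYPE('n) k"
      unfolding opt[symmetric] moment_sum_gauss_moment
      by (intro sum.cong) (simp_all add: mom nf z_def)
    have "gauss_moment (A' j) \<noteq> 0 \<longleftrightarrow> z j \<noteq> 0" if "j \<in> {1..k}" for j
      unfolding mom[OF that] using nf(1)[of "z j"] by (metis norm_eq_zero)
    thus "J = {j\<in>{1..k}. gauss_moment (A' j) \<noteq> 0}"
      unfolding J_def by blast
    show "gauss_moment (A' i) \<bullet> gauss_moment (A' j) < 0" if "i \<in> J" "j \<in> J" "i \<noteq> j" for i j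
      using neg[OF that] that by (simp add: mom nf J_def)
    show "card I + 1 = card J" using I dim by simp
    show "gauss_moment (A' j) \<in> coord_subspace I" if "j \<in> J" for j
      using fU zU[OF that] that by (auto simp: mom J_def)
  qed fact
qed

section \<open>The argmax cells of the rotated maximiser as simplicial cones\<close>

theorem theorem2:
  fixes k :: nat
  assumes "k \<ge> 2" and "CARD('n::finite) = k - 1"
  shows "\<exists>A :: nat \<Rightarrow> (real ^ 'n) set.
           measurable_partition k A \<and>
           moment_sum k A = kernel_C TYPE('n) k \<and>
           simplicial_conical k A"
proof -
  obtain A :: "nat \<Rightarrow> (real ^ 'n) set" and J :: "nat set" and I :: "'n set" where A: "measurable_partition k A"
    and opt: "moment_sum k A = kernel_C TYPE('n) k"
    and J: "J = {j\<in>{1..k}. gauss_moment (A j) \<noteq> 0}" "J \<noteq> {}"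
    and neg: "\<And>i j. i \<in> J \<Longrightarrow> j \<in> J \<Longrightarrow> i \<noteq> j \<Longrightarrow> gauss_moment (A i) \<bullet> gauss_moment (A j) < 0"
    and I: "card I + 1 = card J" "\<And>j. j \<in> J \<Longrightarrow> gauss_moment (A j) \<in> coord_subspace I"
    by (rule kernel_C_attained_in_coord_subspace[OF assms(1), where 'n = 'n]) (rule that)
  define w where "w j = gauss_moment (A j)" for j
  have fin: "finite J" and JK: "J \<subseteq> {1..k}" by (auto simp: J)
  have sum0: "(\<Sum>j\<in>J. w j) = 0"
  proof -
    have "(\<Sum>j=1..k. w j) = (\<Sum>j\<in>J. w j)"
      by (rule sum.mono_neutral_right) (auto simp: J w_def)
    thus ?thesis using sum_gauss_moment_eq_0[OF A] by (simp add: w_def)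
  qed
  \<comment> \<open>Only indices in \<open>J\<close> compete, so the parts with zero moment become
    empty.\<close>
  define D where "D = argmax_cell J w"
  have D: "measurable_partition k D"
    unfolding D_def using JK J(2) by (rule measurable_partition_argmax_cell)
  have nw: "(\<Sum>j=1..k. (norm (w j))\<^sup>2) = kernel_C TYPE('n) k"
    using opt by (simp add: moment_sum_gauss_moment w_def)
  have "(\<Sum>j=1..k. w j \<bullet> gauss_moment (A j)) \<le> (\<Sum>j=1..k. w j \<bullet> gauss_moment (D j))"
  proof (rule sum_inner_gauss_moment_le[OF A D])
    fix x i j assume ij: "i \<in> {1..k}" "j \<in> {1..k}" "x \<in> A i" "x \<in> D j"
    hence j: "j \<in> J" and max: "\<And>l. l \<in> J \<Longrightarrow> x \<bullet> w l \<le> x \<bullet> w j"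
      by (auto simp: D_def argmax_cell_def)
    show "x \<bullet> w i \<le> x \<bullet> w j"
    proof (cases "i \<in> J")
      case False
      with ij have "w i = 0" by (simp add: J w_def)
      \<comment> \<open>The numbers \<open>x \<bullet> w l\<close> over \<open>J\<close> sum to
        zero, so their maximum is nonnegative and beats the value 0 of the indices outside
        \<open>J\<close>.\<close>
      moreover have "0 \<le> real (card J) * (x \<bullet> w j)"
        using sum_bounded_above[of J "\<lambda>l. x \<bullet> w l", OF max] sum0
        by (simp add: inner_sum_right[symmetric])
      ultimately show ?thesis
        using fin j by (auto simp: zero_le_mult_iff)
    qed (rule max)
  qed
  hence mom: "gauss_moment (D j) = w j" if "j \<in> {1..k}" for j
    using gauss_moment_eq_if_optimal[OF D nw _ that] nw by (simp add: w_def power2_norm_eq_inner)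
  have "moment_sum k D = kernel_C TYPE('n) k"
    unfolding moment_sum_gauss_moment nw[symmetric] by (intro sum.cong) (auto simp: mom)
  \<comment> \<open>A null part would have zero moment, so positive measure and nonzero moment
    select the same indices of \<open>D\<close>.\<close>
  moreover have pos: "{j\<in>{1..k}. emeasure std_gauss (D j) > 0} = J"
  proof -
    have "emeasure std_gauss (D j) > 0" if j: "j \<in> J" for j
    proof (rule ccontr)
      assume "\<not> emeasure std_gauss (D j) > 0"
      hence "D j \<in> null_sets std_gauss"
        using D j JK by (auto simp: measurable_partition_def null_sets_def)
      hence "AE x in std_gauss. indicator (D j) x *\<^sub>R x = 0"
        by (auto dest: AE_not_in elim!: eventually_mono)
      hence "gauss_moment (D j) = 0"
        unfolding gauss_moment_def set_lebesgue_integral_def by (rule integral_eq_zero_AE)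
      with mom j show False by (auto simp: J w_def)
    qed
    moreover have "D j = {}" if "j \<notin> J" for j
      using that by (simp add: D_def argmax_cell_def)
    ultimately show ?thesis using JK by fastforce
  qed
  have "\<exists>B. B \<subseteq> coord_subspace I \<and> simplicial_cone (card I) B \<and> D j = {x. coord_proj I x \<in> B}"
    if j: "j \<in> J" for j
  proof -
    define b where "b l = w j - w l" for l
    \<comment> \<open>The cell cut down to the coordinate subspace; strictness for
      \<open>l < j\<close> comes from the tie-breaking.\<close>
    define B where "B = {x\<in>coord_subspace I. \<forall>l\<in>J - {j}. 0 \<le> x \<bullet> b l \<and> (l < j \<longrightarrow> 0 < x \<bullet> b l)}"
    have bI: "b l \<in> coord_subspace I" if "l \<in> J" for l
      unfolding b_def w_def by (intro subspace_diff subspace_coord_subspace I(2) j that)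
    have "inj_on b (J - {j})" "independent (b ` (J - {j}))"
      unfolding b_def using obtuse_differences_independent[OF fin _ sum0 j] neg by (auto simp: w_def)
    moreover have card: "card (J - {j}) = card I"
      using I(1) j by simp
    ultimately have "simplicial_cone (card I) B"
      unfolding B_def card[symmetric] using fin bI
      by (intro simplicial_cone_orthant subspace_coord_subspace)
        (auto simp: dim_coord_subspace card)
    \<comment> \<open>The normals \<open>b l\<close> lie in the coordinate subspace, so membership
      in the cell depends only on the projection.\<close>
    moreover have "x \<in> D j \<longleftrightarrow> coord_proj I x \<in> B" for x
      using j coord_proj_in_coord_subspace[of I x] bI
      by (auto simp: D_def argmax_cell_def B_def inner_coord_proj)
        (auto simp: b_def inner_diff_right)
    hence "D j = {x. coord_proj I x \<in> B}" by blast
    ultimately show ?thesis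
      by (intro exI[of _ B]) (auto simp: B_def)
  qed
  hence "simplicial_conical k D"
    unfolding simplicial_conical_def Let_def pos using I(1) by blast
  ultimately show ?thesis
    using D by blast
qed

end
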